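(* There exists an absolute constant $C > 0$ such that the following holds. Let $p \geq 2$ and $\epsilon \in (0,1)$ be parameters, and let $(X,\mu)$ be a probability space. Suppose \[ f = \lambda_1 g_1 + \cdots + \lambda_N g_N, \] where each $\lambda_j \in \mathbb{C}$, the $\lambda_j$ are not all zero, and each $g_j : X \to \mathbb{C}$ is a measurable function with $\|g_j\|_{L^p(\mu)} \leq 1$. Write $\|\lambda\|_{\ell^1} = \sum_{j=1}^N |\lambda_j|$. Then there is a positive integer $k \leq Cp/\epsilon^2$ and a $k$-tuple $\sigma = (\sigma_1,\ldots,\sigma_k) \in \{1,\ldots,N\}^k$ such that \[ \left\| \tfrac{1}{\|\lambda\|_{\ell^1}}f - \tfrac{1}{k}\left( \lambda_{\sigma_1}^{\circ} g_{\sigma_1} + \cdots + \lambda_{\sigma_k}^{\circ} g_{\sigma_k} \right) \right\|_{L^p(\mu)} \leq \epsilon. \] In fact, for this $k$, the inequality holds with probability at least $0.99$ if the tuple $(\sigma_1, \ldots, \sigma_k)$ is picked at random from $\{1,\ldots,N\}^k$ with probability $|\lambda_{\sigma_1} \cdots \lambda_{\sigma_k}|/\|\lambda\|_{\ell^1}^k$.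
   Context: For a non-zero complex number $\lambda$, $\lambda^{\circ} = \lambda/|\lambda|$, and $0^{\circ} = 0$. $\|g\|_{L^p(\mu)} = \left(\int_X |g|^p\, d\mu\right)^{1/p}$. *)

theory Defs
  imports "HOL-Probability.Probability"
begin

(* The L^p norm (0 < p < infinity), with value infinity when |g|^p is not integrable.
   There is no powr on ennreal, hence the detour through real. *)
definition Lp_norm :: "'a measure \<Rightarrow> real \<Rightarrow> ('a \<Rightarrow> complex) \<Rightarrow> ennreal" where
  "Lp_norm M p g =
    (let I = (\<integral>\<^sup>+ x. ennreal (cmod (g x) powr p) \<partial>M)
     in if I = \<infinity> then \<infinity> else ennreal (enn2real I powr (1 / p)))"

definition l1_norm :: "nat \<Rightarrow> (nat \<Rightarrow> complex) \<Rightarrow> real" where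
  "l1_norm N lam = (\<Sum>j = 1..N. cmod (lam j))"

definition tuples :: "nat \<Rightarrow> nat \<Rightarrow> (nat \<Rightarrow> nat) set" where
  "tuples k N = ({1..k} \<rightarrow>\<^sub>E {1..N})"

definition tuple_distr :: "nat \<Rightarrow> nat \<Rightarrow> (nat \<Rightarrow> complex) \<Rightarrow> (nat \<Rightarrow> nat) measure" where
  "tuple_distr k N lam =
    point_measure (tuples k N) (\<lambda>\<sigma>. ennreal (cmod (\<Prod>i = 1..k. lam (\<sigma> i)) / l1_norm N lam ^ k))"

(* For complex z, the library's sgn z is z / |z| for z \<noteq> 0, and sgn 0 = 0. *)
definition sample_error ::
  "nat \<Rightarrow> (nat \<Rightarrow> complex) \<Rightarrow> (nat \<Rightarrow> 'a \<Rightarrow> complex) \<Rightarrow> ('a \<Rightarrow> complex) \<Rightarrow> nat \<Rightarrow> (nat \<Rightarrow> nat) \<Rightarrow> 'a \<Rightarrow> complex"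
where
  "sample_error N lam g f k \<sigma> x =
     1 / of_real (l1_norm N lam) * f x
     - 1 / of_nat k * (\<Sum>i = 1..k. sgn (lam (\<sigma> i)) * g (\<sigma> i) x)"

definition sampling_constant :: "real \<Rightarrow> 'a measure \<Rightarrow> bool" where
  "sampling_constant C M \<longleftrightarrow>
    (\<forall>(p::real) (\<epsilon>::real) (N::nat) (lam :: nat \<Rightarrow> complex) (g :: nat \<Rightarrow> 'a \<Rightarrow> complex) (f :: 'a \<Rightarrow> complex).
       2 \<le> p \<and> 0 < \<epsilon> \<and> \<epsilon> < 1
       \<and> (\<exists>j\<in>{1..N}. lam j \<noteq> 0)
       \<and> (\<forall>j\<in>{1..N}. g j \<in> borel_measurable M \<and> Lp_norm M p (g j) \<le> 1)
       \<and> (\<forall>x\<in>space M. f x = (\<Sum>j = 1..N. lam j * g j x))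
       \<longrightarrow>
       (\<exists>k::nat. 0 < k \<and> real k \<le> C * p / \<epsilon>\<^sup>2
          \<and> (\<exists>\<sigma>\<in>tuples k N. Lp_norm M p (sample_error N lam g f k \<sigma>) \<le> ennreal \<epsilon>)
          \<and> measure (tuple_distr k N lam)
               {\<sigma> \<in> tuples k N. Lp_norm M p (sample_error N lam g f k \<sigma>) \<le> ennreal \<epsilon>} \<ge> 99 / 100))"

(* HOL cannot quantify over types inside a formula: in "there is C > 0 such that for all
   M :: 'a measure ...", the constant C may depend on the type 'a. To make the constant
   absolute, call C universal if it works for all probability spaces on the one fixed type
   nat \<Rightarrow> complex. If a universal constant exists, and every universal constant works for all
   probability spaces on an arbitrary type 'a, then one and the same C serves all types. *)
definition universal_sampling_constant :: "real \<Rightarrow> bool" where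
  "universal_sampling_constant C \<longleftrightarrow>
    0 < C \<and> (\<forall>M :: (nat \<Rightarrow> complex) measure. prob_space M \<longrightarrow> sampling_constant C M)"

end

theory Submission
  imports Defs
begin

text \<open>The point is that \<open>L\<^sup>p\<close> has type 2 with a constant of order \<open>sqrt p\<close>, and that this
  can be read off pointwise. Give the index \<open>j\<close> the weight \<open>cmod (lam j) / l1_norm N lam\<close>. At
  every \<open>x\<close> the number \<open>f x / l1_norm N lam\<close> is the mean of the random number
  \<open>sgn (lam j) * g j x\<close>, so the sampling error at \<open>x\<close> is a centred empirical mean of \<open>k\<close>
  independent complex random variables with finitely many values. Its \<open>p\<close>-th moment is at most
  \<open>(16 * p / k) powr (p / 2)\<close> times the mean of \<open>cmod (g j x) powr p\<close>
  (\<open>centred_sum_moment\<close>): symmetrization introduces random signs, and Khinchine's inequality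
  with its square-root growth in \<open>p\<close> bounds the signed sums.

  Both sides of the pointwise bound are \<open>p\<close>-th powers, so integration over the space turns it
  into a bound for the mean of the \<open>p\<close>-th power of the \<open>L\<^sup>p\<close> norm of the error
  (\<open>sample_error_moment\<close>). Markov's inequality for the finite space of tuples then shows that
  some \<open>k\<close> of order \<open>p / \<epsilon>\<^sup>2\<close> has failure probability at most \<open>1 / 100\<close>
  (\<open>sampling_constant_1601\<close>), and a good tuple exists because the good tuples have positive
  probability.

  A constant that works on the type \<open>nat \<Rightarrow> complex\<close> works on every type, since the
  assertion depends only on the joint distribution of the \<open>g j\<close>
  (\<open>universal_sampling_constant_imp\<close>).\<close>

section \<open>Averages over independent coordinates\<close>

text \<open>The mean of \<open>h\<close> when the coordinates are independent with law \<open>w\<close> on \<open>J\<close>, for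
  weights \<open>w\<close> of total 1. Written as a
  weighted sum over an arbitrary index set, it covers the random index tuples and the random
  signs alike, and inserting an index into \<open>I\<close> gives an induction over the coordinates.\<close>

definition prod_avg :: "'i set \<Rightarrow> 'j set \<Rightarrow> ('j \<Rightarrow> real) \<Rightarrow> (('i \<Rightarrow> 'j) \<Rightarrow> real) \<Rightarrow> real" where
  "prod_avg I J w h = (\<Sum>\<sigma>\<in>I \<rightarrow>\<^sub>E J. (\<Prod>i\<in>I. w (\<sigma> i)) * h \<sigma>)"

lemma prod_avg_empty [simp]: "prod_avg {} J w h = h (\<lambda>_. undefined)"
  by (simp add: prod_avg_def)

lemma prod_avg_insert:
  assumes "finite I" "i \<notin> I"
  shows "prod_avg (insert i I) J w h = (\<Sum>j\<in>J. w j * prod_avg I J w (\<lambda>\<sigma>. h (\<sigma>(i := j))))"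
proof -
  have w: "(\<Prod>l\<in>I. w ((\<sigma>(i := j)) l)) = (\<Prod>l\<in>I. w (\<sigma> l))" for \<sigma> j
    using assms(2) by (intro prod.cong) auto
  have "prod_avg (insert i I) J w h
      = (\<Sum>(j, \<sigma>)\<in>J \<times> (I \<rightarrow>\<^sub>E J). (w j * (\<Prod>l\<in>I. w (\<sigma> l))) * h (\<sigma>(i := j)))"
    unfolding prod_avg_def PiE_insert_eq using assms
    by (subst sum.reindex[OF inj_combinator[OF assms(2)]])
       (auto simp del: fun_upd_apply simp: w fun_upd_same intro!: sum.cong)
  also have "\<dots> = (\<Sum>j\<in>J. w j * prod_avg I J w (\<lambda>\<sigma>. h (\<sigma>(i := j))))"
    by (simp add: sum.cartesian_product [symmetric] prod_avg_def sum_distrib_left mult.assoc)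
  finally show ?thesis .
qed

lemma prod_avg_cong:
  assumes "\<And>\<sigma>. \<sigma> \<in> I \<rightarrow>\<^sub>E J \<Longrightarrow> h \<sigma> = h' \<sigma>"
  shows "prod_avg I J w h = prod_avg I J w h'"
  unfolding prod_avg_def using assms by (intro sum.cong) auto

lemma prod_avg_mono:
  assumes "\<And>j. j \<in> J \<Longrightarrow> 0 \<le> w j" "\<And>\<sigma>. \<sigma> \<in> I \<rightarrow>\<^sub>E J \<Longrightarrow> h \<sigma> \<le> h' \<sigma>"
  shows "prod_avg I J w h \<le> prod_avg I J w h'"
  unfolding prod_avg_def using assms
  by (intro sum_mono mult_left_mono prod_nonneg) (auto simp: PiE_mem)

lemma prod_avg_cmult: "prod_avg I J w (\<lambda>\<sigma>. c * h \<sigma>) = c * prod_avg I J w h"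
  by (simp add: prod_avg_def sum_distrib_left mult_ac)

lemma prod_avg_divide: "prod_avg I J w (\<lambda>\<sigma>. h \<sigma> / c) = prod_avg I J w h / c"
  by (simp add: prod_avg_def sum_divide_distrib)

lemma prod_avg_add:
  "prod_avg I J w (\<lambda>\<sigma>. h \<sigma> + h' \<sigma>) = prod_avg I J w h + prod_avg I J w h'"
  by (simp add: prod_avg_def distrib_left sum.distrib)

lemma prod_avg_prod:
  assumes "finite I" "finite J"
  shows "prod_avg I J w (\<lambda>\<sigma>. \<Prod>i\<in>I. f i (\<sigma> i)) = (\<Prod>i\<in>I. \<Sum>j\<in>J. w j * f i j)"
  unfolding prod_avg_def using assms by (simp add: prod_sum_PiE prod.distrib)

lemma prod_avg_const:
  assumes "finite I" "finite J" "(\<Sum>j\<in>J. w j) = 1"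
  shows "prod_avg I J w (\<lambda>_. c) = c"
  using prod_avg_prod[OF assms(1,2), where w = w and f = "\<lambda>_ _. 1"] assms(3)
    prod_avg_cmult[where h = "\<lambda>_. 1" and c = c and I = I and J = J and w = w] by simp

lemma prod_avg_sum_coordinates:
  assumes "finite I" "finite J" "(\<Sum>j\<in>J. w j) = 1"
  shows "prod_avg I J w (\<lambda>\<sigma>. \<Sum>i\<in>I. h (\<sigma> i)) = real (card I) * (\<Sum>j\<in>J. w j * h j)"
  using assms(1)
proof induction
  case empty
  then show ?case by simp
next
  case (insert i I)
  have eq: "(\<Sum>l\<in>insert i I. h ((\<sigma>(i := j)) l)) = h j + (\<Sum>l\<in>I. h (\<sigma> l))" for \<sigma> j
  proof -
    have "(\<Sum>l\<in>I. h ((\<sigma>(i := j)) l)) = (\<Sum>l\<in>I. h (\<sigma> l))"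
      using insert by (intro sum.cong) auto
    then show ?thesis using insert by simp
  qed
  show ?case
    unfolding prod_avg_insert[OF insert(1,2)] eq prod_avg_add insert.IH
      prod_avg_const[OF insert(1) assms(2,3)]
    using insert assms(3)
    by (simp add: distrib_left distrib_right sum.distrib sum_distrib_right [symmetric])
qed

section \<open>Symmetrization\<close>

text \<open>Since \<open>v + a j - a l\<close> is the midpoint of \<open>v + 2 * a j\<close> and \<open>v - 2 * a l\<close>, Jensen's
  inequality over an independent copy \<open>l\<close> of \<open>j\<close> followed by midpoint convexity exchanges the
  centring at the mean for a random sign, at the price of a factor 2.\<close>

lemma symmetrization_step:
  fixes a :: "'j \<Rightarrow> 'v::real_vector"
  assumes "finite J" "\<And>j. j \<in> J \<Longrightarrow> 0 \<le> w j" "(\<Sum>j\<in>J. w j) = 1" "convex_on UNIV \<phi>"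
  shows "(\<Sum>j\<in>J. w j * \<phi> (v + (a j - (\<Sum>l\<in>J. w l *\<^sub>R a l))))
       \<le> (\<Sum>j\<in>J. w j * ((\<phi> (v + 2 *\<^sub>R a j) + \<phi> (v - 2 *\<^sub>R a j)) / 2))"
proof -
  have ne: "J \<noteq> {}" using assms(3) by auto
  have mid: "\<phi> (v + a j - a l) \<le> (\<phi> (v + 2 *\<^sub>R a j) + \<phi> (v - 2 *\<^sub>R a l)) / 2" for j l
  proof -
    have eq: "(1 - 1/2) *\<^sub>R (v + 2 *\<^sub>R a j) + (1/2) *\<^sub>R (v - 2 *\<^sub>R a l)
        = (1/2) *\<^sub>R v + (1/2) *\<^sub>R v + a j - a l"
      by (simp add: scaleR_add_right scaleR_diff_right)
    then have eq': "\<dots> = v + a j - a l"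
      by (simp add: scaleR_left_distrib [symmetric])
    show ?thesis
      using convex_onD[OF assms(4), of "1/2" "v + 2 *\<^sub>R a j" "v - 2 *\<^sub>R a l"]
      unfolding eq eq' by simp
  qed
  have jensen: "\<phi> (v + (a j - (\<Sum>l\<in>J. w l *\<^sub>R a l))) \<le> (\<Sum>l\<in>J. w l * \<phi> (v + a j - a l))" for j
  proof -
    have "v + (a j - (\<Sum>l\<in>J. w l *\<^sub>R a l)) = (\<Sum>l\<in>J. w l *\<^sub>R (v + a j - a l))"
      using assms(3)
      by (simp add: scaleR_diff_right sum_subtractf scaleR_left.sum [symmetric])
    then show ?thesis
      using convex_on_sum[OF assms(1) ne assms(4,3,2), of "\<lambda>l. v + a j - a l"] by simp
  qed
  have "(\<Sum>j\<in>J. w j * \<phi> (v + (a j - (\<Sum>l\<in>J. w l *\<^sub>R a l))))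
      \<le> (\<Sum>j\<in>J. w j * (\<Sum>l\<in>J. w l * ((\<phi> (v + 2 *\<^sub>R a j) + \<phi> (v - 2 *\<^sub>R a l)) / 2)))"
    using assms(2)
    by (intro sum_mono mult_left_mono order_trans[OF jensen] mid) auto
  also have "\<dots> = (\<Sum>j\<in>J. w j * (\<phi> (v + 2 *\<^sub>R a j) / 2 + (\<Sum>l\<in>J. w l * (\<phi> (v - 2 *\<^sub>R a l) / 2))))"
    using assms(3)
    by (simp add: add_divide_distrib distrib_left sum.distrib sum_distrib_right [symmetric]
        del: times_divide_eq_right)
  also have "\<dots> = (\<Sum>j\<in>J. w j * ((\<phi> (v + 2 *\<^sub>R a j) + \<phi> (v - 2 *\<^sub>R a j)) / 2))"
    using assms(3)
    by (simp add: add_divide_distrib distrib_left sum.distrib sum_distrib_right [symmetric]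
        del: times_divide_eq_right)
  finally show ?thesis .
qed

abbreviation sign_avg :: "'i set \<Rightarrow> (('i \<Rightarrow> real) \<Rightarrow> real) \<Rightarrow> real" where
  "sign_avg I \<equiv> prod_avg I {-1, 1} (\<lambda>_. 1/2)"

lemma convex_on_UNIV_translate:
  fixes \<phi> :: "'v::real_vector \<Rightarrow> real"
  assumes "convex_on UNIV \<phi>"
  shows "convex_on UNIV (\<lambda>v. \<phi> (v + c))"
proof (rule convex_onI)
  fix t :: real and x y :: 'v
  assume t: "0 < t" "t < 1"
  have "(1 - t) *\<^sub>R x + t *\<^sub>R y + c = (1 - t) *\<^sub>R (x + c) + t *\<^sub>R (y + c)"
    by (simp add: algebra_simps)
  then show "\<phi> ((1 - t) *\<^sub>R x + t *\<^sub>R y + c) \<le> (1 - t) * \<phi> (x + c) + t * \<phi> (y + c)"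
    using convex_onD[OF assms, of t "x + c" "y + c"] t by simp
qed auto

lemma convex_on_sum_functions:
  fixes h :: "'t \<Rightarrow> 'v::real_vector \<Rightarrow> real"
  assumes "finite T" "convex S" "\<And>t. t \<in> T \<Longrightarrow> convex_on S (h t)"
  shows "convex_on S (\<lambda>v. \<Sum>t\<in>T. h t v)"
  using assms(1,3)
proof induction
  case empty
  then show ?case using assms(2) by (simp add: convex_on_def)
next
  case (insert t T)
  then show ?case by (simp add: convex_on_add)
qed

text \<open>The single step is used once per coordinate. Keeping the shift \<open>v\<close> arbitrary makes the
  average over the remaining coordinates again a convex function of the contribution of the
  coordinate under treatment.\<close>

lemma symmetrization:
  fixes a :: "'j \<Rightarrow> 'v::real_vector"
  assumes "finite I" "finite J" "\<And>j. j \<in> J \<Longrightarrow> 0 \<le> w j" "(\<Sum>j\<in>J. w j) = 1" "convex_on UNIV \<phi>"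
  shows "prod_avg I J w (\<lambda>\<sigma>. \<phi> (v + (\<Sum>i\<in>I. a (\<sigma> i) - (\<Sum>l\<in>J. w l *\<^sub>R a l))))
       \<le> prod_avg I J w (\<lambda>\<sigma>. sign_avg I (\<lambda>s. \<phi> (v + (\<Sum>i\<in>I. s i *\<^sub>R (2 *\<^sub>R a (\<sigma> i))))))"
  using assms(1)
proof (induction arbitrary: v)
  case empty
  then show ?case by simp
next
  case (insert i I)
  define m where "m = (\<Sum>l\<in>J. w l *\<^sub>R a l)"
  define \<psi> where "\<psi> = (\<lambda>v. prod_avg I J w (\<lambda>\<sigma>. \<phi> (v + (\<Sum>l\<in>I. a (\<sigma> l) - m))))"
  define S where "S = (\<lambda>v \<sigma>. sign_avg I (\<lambda>s. \<phi> (v + (\<Sum>l\<in>I. s l *\<^sub>R (2 *\<^sub>R a (\<sigma> l))))))"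
  have IH: "\<psi> v \<le> prod_avg I J w (S v)" for v
    using insert.IH unfolding \<psi>_def S_def m_def .
  have upd: "(\<Sum>l\<in>insert i I. a ((\<sigma>(i := j)) l) - m) = (a j - m) + (\<Sum>l\<in>I. a (\<sigma> l) - m)"
    for \<sigma> j
  proof -
    have "(\<Sum>l\<in>I. a ((\<sigma>(i := j)) l) - m) = (\<Sum>l\<in>I. a (\<sigma> l) - m)"
      using insert(2) by (intro sum.cong) auto
    then show ?thesis using insert(1,2) by simp
  qed
  have upd2: "(\<Sum>l\<in>insert i I. (s(i := e)) l *\<^sub>R (2 *\<^sub>R a ((\<sigma>(i := j)) l)))
      = e *\<^sub>R (2 *\<^sub>R a j) + (\<Sum>l\<in>I. s l *\<^sub>R (2 *\<^sub>R a (\<sigma> l)))" for s \<sigma> j e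
  proof -
    have "(\<Sum>l\<in>I. (s(i := e)) l *\<^sub>R (2 *\<^sub>R a ((\<sigma>(i := j)) l)))
        = (\<Sum>l\<in>I. s l *\<^sub>R (2 *\<^sub>R a (\<sigma> l)))"
      using insert(2) by (intro sum.cong) auto
    then show ?thesis using insert(1,2) by simp
  qed
  have conv: "convex_on UNIV \<psi>"
    unfolding \<psi>_def prod_avg_def using assms(3)
    by (intro convex_on_sum_functions finite_PiE insert.hyps assms(2) convex_UNIV convex_on_cmul
        prod_nonneg convex_on_UNIV_translate[OF assms(5)]) (auto simp: PiE_mem)
  have "prod_avg (insert i I) J w (\<lambda>\<sigma>. \<phi> (v + (\<Sum>l\<in>insert i I. a (\<sigma> l) - m)))
      = (\<Sum>j\<in>J. w j * \<psi> (v + (a j - m)))"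
    unfolding prod_avg_insert[OF insert(1,2)] upd \<psi>_def by (simp add: add.assoc)
  also have "\<dots> \<le> (\<Sum>j\<in>J. w j * ((\<psi> (v + 2 *\<^sub>R a j) + \<psi> (v - 2 *\<^sub>R a j)) / 2))"
    unfolding m_def by (intro symmetrization_step assms(2-4) conv)
  also have "\<dots> \<le> (\<Sum>j\<in>J. w j * ((prod_avg I J w (S (v - 2 *\<^sub>R a j))
                                   + prod_avg I J w (S (v + 2 *\<^sub>R a j))) / 2))"
  proof (intro sum_mono mult_left_mono divide_right_mono)
    show "\<psi> (v + 2 *\<^sub>R a j) + \<psi> (v - 2 *\<^sub>R a j)
        \<le> prod_avg I J w (S (v - 2 *\<^sub>R a j)) + prod_avg I J w (S (v + 2 *\<^sub>R a j))" for j
      using IH[of "v + 2 *\<^sub>R a j"] IH[of "v - 2 *\<^sub>R a j"] by linarith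
  qed (use assms(3) in auto)
  also have "\<dots> = prod_avg (insert i I) J w
      (\<lambda>\<sigma>. sign_avg (insert i I) (\<lambda>s. \<phi> (v + (\<Sum>l\<in>insert i I. s l *\<^sub>R (2 *\<^sub>R a (\<sigma> l))))))"
  proof -
    have sub: "v - x + y = v + (y - x)" for x y :: 'v
      by simp
    show ?thesis
      unfolding prod_avg_insert[OF insert(1,2)] upd2
      by (simp add: S_def prod_avg_add prod_avg_divide add_divide_distrib add.assoc sub)
  qed
  finally show ?case unfolding m_def .
qed

section \<open>Khinchine's inequality\<close>

text \<open>This is Hoeffding's lemma for a fair sign: with \<open>p = 1/2\<close> and \<open>h = 2 * \<bar>x\<bar>\<close> its
  logarithmic moment generating function is \<open>ln (cosh x)\<close>.\<close>

lemma cosh_le_exp_half_square: "cosh (x::real) \<le> exp (x\<^sup>2 / 2)"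
proof -
  have half: "1 + 1/2 * (exp (2 * y) - 1) = exp y * cosh y" for y :: real
    by (simp add: cosh_def exp_minus field_simps flip: exp_add)
  have "ln (cosh \<bar>x\<bar>) \<le> x\<^sup>2 / 2"
    using Hoeffdings_lemma_aux[of "2 * \<bar>x\<bar>" "1/2"] unfolding half
    by (simp add: ln_mult power_mult_distrib)
  then have "cosh \<bar>x\<bar> \<le> exp (x\<^sup>2 / 2)"
    by (metis cosh_real_pos exp_le_cancel_iff exp_ln)
  then show ?thesis by (simp add: cosh_real_abs)
qed

lemma sign_avg_exp_le:
  assumes "finite I"
  shows "sign_avg I (\<lambda>s. exp (\<Sum>i\<in>I. s i * c i)) \<le> exp ((\<Sum>i\<in>I. (c i)\<^sup>2) / 2)"
proof -
  have "sign_avg I (\<lambda>s. exp (\<Sum>i\<in>I. s i * c i)) = (\<Prod>i\<in>I. cosh (c i))"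
    using assms by (simp add: exp_sum prod_avg_prod[where f = "\<lambda>i e. exp (e * c i)"] cosh_def
        add_divide_distrib add.commute)
  also have "\<dots> \<le> (\<Prod>i\<in>I. exp ((c i)\<^sup>2 / 2))"
    by (intro prod_mono conjI cosh_le_exp_half_square) (simp add: less_imp_le)
  also have "\<dots> = exp ((\<Sum>i\<in>I. (c i)\<^sup>2) / 2)"
    using assms by (simp add: exp_sum sum_divide_distrib)
  finally show ?thesis .
qed

text \<open>The maximum of \<open>x powr p * exp (- t * x)\<close> over \<open>x \<ge> 0\<close> is attained at \<open>x = p / t\<close>.\<close>

lemma powr_le_exp:
  assumes "0 \<le> x" "0 < t" "0 < (p::real)"
  shows "x powr p \<le> (p / t) powr p * exp (t * x - p)"
proof -
  have "t * x / p \<le> exp (t * x / p - 1)"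
    using exp_ge_add_one_self[of "t * x / p - 1"] by simp
  then have "(t * x / p) powr p \<le> exp (t * x / p - 1) powr p"
    using assms by (intro powr_mono2) auto
  also have "\<dots> = exp (t * x - p)"
    using assms by (simp add: powr_def algebra_simps)
  finally have "(p / t) powr p * (t * x / p) powr p \<le> (p / t) powr p * exp (t * x - p)"
    by (intro mult_left_mono) auto
  moreover have "(p / t) powr p * (t * x / p) powr p = x powr p"
    using assms by (simp flip: powr_mult)
  ultimately show ?thesis by simp
qed

text \<open>This reduces a complex sum to real exponential moments: the modulus is at most
  \<open>\<bar>Re z\<bar> + \<bar>Im z\<bar>\<close>, the two parts are decoupled by the inequality between the arithmetic and
  geometric means, and an absolute value costs one exponential for each sign.\<close>

lemma exp_cmod_le:
  assumes "0 \<le> t"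
  shows "exp (t * cmod z) \<le> (exp (2 * t * Re z) + exp (2 * t * - Re z)
                            + exp (2 * t * Im z) + exp (2 * t * - Im z)) / 2"
proof -
  have am_gm: "exp (a + b) \<le> (exp (2 * a) + exp (2 * b)) / 2" for a b :: real
    using sum_squares_bound[of "exp a" "exp b"] by (simp add: exp_add exp_double)
  have abs: "exp (2 * (t * \<bar>y\<bar>)) \<le> exp (2 * t * y) + exp (2 * t * - y)" for y
    by (cases "0 \<le> y") (auto simp: mult.assoc)
  have "exp (t * cmod z) \<le> exp (t * \<bar>Re z\<bar> + t * \<bar>Im z\<bar>)"
    using mult_left_mono[OF cmod_le assms, of z] by (simp add: distrib_left)
  also have "\<dots> \<le> (exp (2 * (t * \<bar>Re z\<bar>)) + exp (2 * (t * \<bar>Im z\<bar>))) / 2"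
    by (rule am_gm)
  also have "\<dots> \<le> ((exp (2 * t * Re z) + exp (2 * t * - Re z))
                  + (exp (2 * t * Im z) + exp (2 * t * - Im z))) / 2"
    by (intro divide_right_mono add_mono abs) auto
  finally show ?thesis by simp
qed

text \<open>The growth of order \<open>p powr (p / 2)\<close> comes from comparing \<open>x powr p\<close> with the exponential
  moment at the scale \<open>t\<^sup>2 = p / (4 A)\<close>, which is optimal for a sub-Gaussian bound
  \<open>exp (2 * t\<^sup>2 * A)\<close>.\<close>

lemma khinchine_complex:
  fixes b :: "'i \<Rightarrow> complex"
  assumes "finite I" "2 \<le> p"
  shows "sign_avg I (\<lambda>s. cmod (\<Sum>i\<in>I. s i *\<^sub>R b i) powr p)
       \<le> (4 * p * (\<Sum>i\<in>I. (cmod (b i))\<^sup>2)) powr (p / 2)"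
proof -
  define A where "A = (\<Sum>i\<in>I. (cmod (b i))\<^sup>2)"
  have A0: "0 \<le> A" unfolding A_def by (intro sum_nonneg) auto
  show ?thesis
  proof (cases "A = 0")
    case True
    then have "b i = 0" if "i \<in> I" for i
      using that assms(1) by (simp add: A_def sum_nonneg_eq_0_iff)
    then have "sign_avg I (\<lambda>s. cmod (\<Sum>i\<in>I. s i *\<^sub>R b i) powr p) = sign_avg I (\<lambda>_. 0)"
      using assms by (intro prod_avg_cong) simp
    then show ?thesis using assms by (simp add: prod_avg_const)
  next
    case False
    with A0 have A: "0 < A" by simp
    define t where "t = sqrt (p / (4 * A))"
    have t: "0 < t" and t2: "t\<^sup>2 = p / (4 * A)"
      unfolding t_def using A assms by (auto simp: less_imp_le)
    define Sb where "Sb = (\<lambda>s. \<Sum>i\<in>I. s i *\<^sub>R b i)"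
    have part: "sign_avg I (\<lambda>s. exp (2 * t * c (Sb s))) \<le> exp (p / 2)"
      if c: "\<And>s. c (Sb s) = (\<Sum>i\<in>I. s i * c (b i))" "\<And>z. \<bar>c z\<bar> \<le> cmod z" for c
    proof -
      have "sign_avg I (\<lambda>s. exp (2 * t * c (Sb s)))
          \<le> exp ((\<Sum>i\<in>I. (2 * t * c (b i))\<^sup>2) / 2)"
        using sign_avg_exp_le[OF assms(1), of "\<lambda>i. 2 * t * c (b i)"]
        by (simp add: c(1) sum_distrib_left mult_ac)
      also have "(\<Sum>i\<in>I. (2 * t * c (b i))\<^sup>2) / 2 = 2 * t\<^sup>2 * (\<Sum>i\<in>I. (c (b i))\<^sup>2)"
        by (simp add: power_mult_distrib sum_distrib_left sum_divide_distrib mult.assoc)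
      also have "\<dots> \<le> 2 * t\<^sup>2 * A"
        unfolding A_def using c(2) by (intro mult_left_mono sum_mono) (auto simp: abs_le_square_iff [symmetric])
      also have "\<dots> = p / 2" using A by (simp add: t2)
      finally show ?thesis by simp
    qed
    have "sign_avg I (\<lambda>s. cmod (Sb s) powr p)
        \<le> sign_avg I (\<lambda>s. ((p / t) powr p * exp (- p) / 2) *
            (exp (2 * t * Re (Sb s)) + exp (2 * t * - Re (Sb s))
           + exp (2 * t * Im (Sb s)) + exp (2 * t * - Im (Sb s))))"
    proof (intro prod_avg_mono)
      fix s
      have "cmod (Sb s) powr p \<le> (p / t) powr p * exp (- p) * exp (t * cmod (Sb s))"
        using powr_le_exp[of "cmod (Sb s)" t p] t assms by (simp add: exp_diff exp_minus field_simps)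
      also have "\<dots> \<le> (p / t) powr p * exp (- p) *
          ((exp (2 * t * Re (Sb s)) + exp (2 * t * - Re (Sb s))
           + exp (2 * t * Im (Sb s)) + exp (2 * t * - Im (Sb s))) / 2)"
        using t by (intro mult_left_mono exp_cmod_le) auto
      finally show "cmod (Sb s) powr p \<le> ((p / t) powr p * exp (- p) / 2) *
            (exp (2 * t * Re (Sb s)) + exp (2 * t * - Re (Sb s))
           + exp (2 * t * Im (Sb s)) + exp (2 * t * - Im (Sb s)))" by simp
    qed simp
    also have "\<dots> \<le> ((p / t) powr p * exp (- p) / 2) * (exp (p/2) + exp (p/2) + exp (p/2) + exp (p/2))"
      unfolding prod_avg_cmult prod_avg_add
      by (intro mult_left_mono add_mono part[of Re] part[of Im] part[of "\<lambda>z. - Re z"] part[of "\<lambda>z. - Im z"])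
         (auto simp: Sb_def abs_Re_le_cmod abs_Im_le_cmod sum_negf)
    also have "\<dots> = (p / t) powr p * (2 * exp (- (p / 2)))"
    proof -
      have "exp (- p) * exp (p / 2) = exp (- (p / 2))" by (simp flip: exp_add)
      then show ?thesis by (simp add: algebra_simps)
    qed
    also have "\<dots> \<le> (p / t) powr p * 1"
    proof (intro mult_left_mono)
      have "2 \<le> exp (p / 2)"
        using exp_ge_add_one_self[of "p / 2"] assms(2) by linarith
      then show "2 * exp (- (p / 2)) \<le> 1" by (simp add: exp_minus field_simps)
    qed simp
    also have "\<dots> = ((p / t)\<^sup>2) powr (p / 2)"
      using t assms by (simp add: powr_powr flip: powr_numeral)
    also have "(p / t)\<^sup>2 = 4 * p * A"
      using A assms by (simp add: power_divide t2) (simp add: power2_eq_square)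
    finally show ?thesis unfolding A_def Sb_def .
  qed
qed

section \<open>Moments of centred sums\<close>

text \<open>The point 0 is included because it is the modulus of a vanishing sum.\<close>

lemma convex_on_powr_nonneg:
  assumes "1 \<le> (p::real)"
  shows "convex_on {0..} (\<lambda>x. x powr p)"
proof (rule convex_on_linorderI)
  fix t x y :: real
  assume *: "0 < t" "t < 1" "x \<in> {0..}" "y \<in> {0..}" "x < y"
  show "((1 - t) *\<^sub>R x + t *\<^sub>R y) powr p \<le> (1 - t) * x powr p + t * y powr p"
  proof (cases "x = 0")
    case True
    have "t powr p \<le> t"
      using powr_mono'[of 1 p t] assms * by simp
    then show ?thesis
      using True * assms by (simp add: powr_mult mult_right_mono)
  next
    case False
    then show ?thesis
      using convex_onD[OF powr_convex[OF assms], of t x y] * by simp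
  qed
qed auto

lemma convex_on_cmod_powr:
  assumes "1 \<le> (p::real)"
  shows "convex_on UNIV (\<lambda>z. cmod z powr p)"
proof (rule convex_onI)
  fix t :: real and x y :: complex
  assume t: "0 < t" "t < 1"
  have "cmod ((1 - t) *\<^sub>R x + t *\<^sub>R y) \<le> (1 - t) * cmod x + t * cmod y"
    using norm_triangle_ineq[of "(1 - t) *\<^sub>R x" "t *\<^sub>R y"] t by simp
  then have "cmod ((1 - t) *\<^sub>R x + t *\<^sub>R y) powr p \<le> ((1 - t) * cmod x + t * cmod y) powr p"
    using assms by (intro powr_mono2) auto
  also have "\<dots> \<le> (1 - t) * cmod x powr p + t * cmod y powr p"
    using convex_onD[OF convex_on_powr_nonneg[OF assms], of t "cmod x" "cmod y"] t by simp
  finally show "cmod ((1 - t) *\<^sub>R x + t *\<^sub>R y) powr p \<le> (1 - t) * cmod x powr p + t * cmod y powr p" .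
qed auto

lemma sum_powr_le_card:
  assumes "finite I" "I \<noteq> {}" "\<And>i. i \<in> I \<Longrightarrow> 0 \<le> y i" "1 \<le> (q::real)"
  shows "(\<Sum>i\<in>I. y i) powr q \<le> real (card I) powr q / real (card I) * (\<Sum>i\<in>I. y i powr q)"
proof -
  define n where "n = real (card I)"
  have n: "0 < n" using assms by (simp add: n_def card_gt_0_iff)
  have "(\<Sum>i\<in>I. (1 / n) *\<^sub>R y i) powr q \<le> (\<Sum>i\<in>I. 1 / n * y i powr q)"
    using assms n
    by (intro convex_on_sum[where C = "{0..}"] convex_on_powr_nonneg) (auto simp: n_def)
  then have le: "((\<Sum>i\<in>I. y i) / n) powr q \<le> (\<Sum>i\<in>I. y i powr q) / n"
    by (simp add: sum_divide_distrib)
  have "(\<Sum>i\<in>I. y i) powr q = n powr q * ((\<Sum>i\<in>I. y i) / n) powr q"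
    using n by (simp flip: powr_mult)
  also have "\<dots> \<le> n powr q * ((\<Sum>i\<in>I. y i powr q) / n)"
    by (intro mult_left_mono le) auto
  finally show ?thesis by (simp add: n_def)
qed

text \<open>A Marcinkiewicz--Zygmund inequality with the sharp order \<open>sqrt p\<close> of the constant.
  Symmetrization replaces the centred summands by \<open>2 * a (\<sigma> i)\<close> with random signs; for fixed
  \<open>\<sigma>\<close> these are controlled by Khinchine's inequality, and convexity of \<open>x powr (p / 2)\<close> turns
  the sum of squares into a sum of \<open>p\<close>-th powers, whose average is computed coordinatewise.\<close>

lemma centred_sum_moment:
  fixes a :: "'j \<Rightarrow> complex"
  assumes "finite I" "I \<noteq> {}" "finite J" "\<And>j. j \<in> J \<Longrightarrow> 0 \<le> w j" "(\<Sum>j\<in>J. w j) = 1" "2 \<le> p"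
  shows "prod_avg I J w (\<lambda>\<sigma>. cmod (\<Sum>i\<in>I. a (\<sigma> i) - (\<Sum>l\<in>J. w l *\<^sub>R a l)) powr p)
       \<le> (16 * p * real (card I)) powr (p / 2) * (\<Sum>j\<in>J. w j * cmod (a j) powr p)"
proof -
  define n where "n = real (card I)"
  have n: "0 < n" using assms by (simp add: n_def card_gt_0_iff)
  have signs: "sign_avg I (\<lambda>s. cmod (\<Sum>i\<in>I. s i *\<^sub>R (2 *\<^sub>R a (\<sigma> i))) powr p)
      \<le> (16 * p * n) powr (p / 2) / n * (\<Sum>i\<in>I. cmod (a (\<sigma> i)) powr p)" for \<sigma> :: "'a \<Rightarrow> 'j"
  proof -
    have sq: "(x\<^sup>2) powr (p / 2) = x powr p" if "0 \<le> x" for x :: real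
      using that by (cases "x = 0") (simp_all add: powr_powr flip: powr_numeral)
    have "sign_avg I (\<lambda>s. cmod (\<Sum>i\<in>I. s i *\<^sub>R (2 *\<^sub>R a (\<sigma> i))) powr p)
        \<le> (4 * p * (\<Sum>i\<in>I. (cmod (2 *\<^sub>R a (\<sigma> i)))\<^sup>2)) powr (p / 2)"
      by (rule khinchine_complex) (use assms in auto)
    also have "4 * p * (\<Sum>i\<in>I. (cmod (2 *\<^sub>R a (\<sigma> i)))\<^sup>2) = 16 * p * (\<Sum>i\<in>I. (cmod (a (\<sigma> i)))\<^sup>2)"
      by (simp add: power_mult_distrib sum_distrib_left mult.assoc)
    also have "\<dots> powr (p / 2) = (16 * p) powr (p / 2) * (\<Sum>i\<in>I. (cmod (a (\<sigma> i)))\<^sup>2) powr (p / 2)"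
      using assms by (intro powr_mult)
    also have "\<dots> \<le> (16 * p) powr (p / 2) * (n powr (p / 2) / n * (\<Sum>i\<in>I. ((cmod (a (\<sigma> i)))\<^sup>2) powr (p / 2)))"
      unfolding n_def using assms by (intro mult_left_mono sum_powr_le_card) auto
    also have "\<dots> = (16 * p * n) powr (p / 2) / n * (\<Sum>i\<in>I. cmod (a (\<sigma> i)) powr p)"
      using assms n by (simp add: sq powr_mult)
    finally show ?thesis .
  qed
  have "prod_avg I J w (\<lambda>\<sigma>. cmod (\<Sum>i\<in>I. a (\<sigma> i) - (\<Sum>l\<in>J. w l *\<^sub>R a l)) powr p)
      \<le> prod_avg I J w (\<lambda>\<sigma>. sign_avg I (\<lambda>s. cmod (\<Sum>i\<in>I. s i *\<^sub>R (2 *\<^sub>R a (\<sigma> i))) powr p))"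
    using symmetrization[OF assms(1,3,4,5) convex_on_cmod_powr, of p 0 a] assms(6) by simp
  also have "\<dots> \<le> prod_avg I J w
      (\<lambda>\<sigma>. (16 * p * n) powr (p / 2) / n * (\<Sum>i\<in>I. cmod (a (\<sigma> i)) powr p))"
    by (intro prod_avg_mono signs assms)
  also have "\<dots> = (16 * p * n) powr (p / 2) * (\<Sum>j\<in>J. w j * cmod (a j) powr p)"
    using n unfolding prod_avg_cmult
    by (subst prod_avg_sum_coordinates[OF assms(1,3,5)]) (simp add: n_def)
  finally show ?thesis unfolding n_def .
qed

section \<open>The sampling bound\<close>

lemma Lp_norm_le_iff:
  assumes "0 < p" "0 \<le> c"
  shows "Lp_norm M p g \<le> ennreal c \<longleftrightarrow> (\<integral>\<^sup>+ x. ennreal (cmod (g x) powr p) \<partial>M) \<le> ennreal (c powr p)"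
proof (cases "\<integral>\<^sup>+ x. ennreal (cmod (g x) powr p) \<partial>M")
  case (real r)
  have "r powr (1 / p) \<le> c \<longleftrightarrow> r \<le> c powr p"
  proof
    assume "r powr (1 / p) \<le> c"
    then have "(r powr (1 / p)) powr p \<le> c powr p"
      using assms by (intro powr_mono2) auto
    then show "r \<le> c powr p" using assms real by (simp add: powr_powr)
  next
    assume "r \<le> c powr p"
    then have "r powr (1 / p) \<le> (c powr p) powr (1 / p)"
      using assms real by (intro powr_mono2) auto
    then show "r powr (1 / p) \<le> c" using assms by (simp add: powr_powr)
  qed
  then show ?thesis
    using real assms by (simp add: Lp_norm_def Let_def ennreal_le_iff)
next
  case top
  then show ?thesis by (simp add: Lp_norm_def Let_def top_unique)
qed

lemma Lp_norm_cong:
  assumes "\<And>x. x \<in> space M \<Longrightarrow> g x = h x"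
  shows "Lp_norm M p g = Lp_norm M p h"
proof -
  have "(\<integral>\<^sup>+ x. ennreal (cmod (g x) powr p) \<partial>M) = (\<integral>\<^sup>+ x. ennreal (cmod (h x) powr p) \<partial>M)"
    using assms by (intro nn_integral_cong) simp
  then show ?thesis by (simp add: Lp_norm_def)
qed

lemma Lp_norm_distr:
  assumes "T \<in> measurable M P" "g \<in> borel_measurable P"
  shows "Lp_norm (distr M P T) p g = Lp_norm M p (\<lambda>x. g (T x))"
proof -
  have "(\<integral>\<^sup>+ y. ennreal (cmod (g y) powr p) \<partial>distr M P T)
      = (\<integral>\<^sup>+ x. ennreal (cmod (g (T x)) powr p) \<partial>M)"
    using assms by (intro nn_integral_distr) auto
  then show ?thesis by (simp add: Lp_norm_def)
qed

lemma measure_tuple_distr: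
  "measure (tuple_distr k N lam) {\<sigma> \<in> tuples k N. P \<sigma>}
     = prod_avg {1..k} {1..N} (\<lambda>j. cmod (lam j) / l1_norm N lam) (\<lambda>\<sigma>. if P \<sigma> then 1 else 0)"
proof -
  have fin: "finite (tuples k N)"
    unfolding tuples_def by (intro finite_PiE) auto
  have L: "0 \<le> l1_norm N lam"
    unfolding l1_norm_def by (intro sum_nonneg) auto
  have w: "cmod (\<Prod>i = 1..k. lam (\<sigma> i)) / l1_norm N lam ^ k
      = (\<Prod>i\<in>{1..k}. cmod (lam (\<sigma> i)) / l1_norm N lam)" for \<sigma> :: "nat \<Rightarrow> nat"
    by (simp add: prod_dividef prod_norm)
  have nonneg: "0 \<le> (\<Prod>i\<in>{1..k}. cmod (lam (\<sigma> i)) / l1_norm N lam)" for \<sigma> :: "nat \<Rightarrow> nat"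
    using L by (intro prod_nonneg) auto
  have "emeasure (tuple_distr k N lam) {\<sigma> \<in> tuples k N. P \<sigma>}
      = (\<Sum>\<sigma> | \<sigma> \<in> tuples k N \<and> P \<sigma>. ennreal (\<Prod>i\<in>{1..k}. cmod (lam (\<sigma> i)) / l1_norm N lam))"
    unfolding tuple_distr_def w by (rule emeasure_point_measure_finite[OF fin]) auto
  then have "measure (tuple_distr k N lam) {\<sigma> \<in> tuples k N. P \<sigma>}
      = (\<Sum>\<sigma> | \<sigma> \<in> tuples k N \<and> P \<sigma>. \<Prod>i\<in>{1..k}. cmod (lam (\<sigma> i)) / l1_norm N lam)"
    using nonneg by (simp add: measure_def sum_ennreal sum_nonneg)
  also have "\<dots> = (\<Sum>\<sigma>\<in>tuples k N. (\<Prod>i\<in>{1..k}. cmod (lam (\<sigma> i)) / l1_norm N lam) * (if P \<sigma> then 1 else 0))"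
    using fin by (intro sum.mono_neutral_cong_left) auto
  finally show ?thesis
    by (simp add: prod_avg_def tuples_def)
qed

text \<open>Markov's inequality, passed to the complementary event. The values of \<open>V\<close> are extended
  because they will be integrals, whose finiteness need not be settled first.\<close>

lemma prod_avg_markov:
  assumes "finite I" "finite J" "\<And>j. j \<in> J \<Longrightarrow> 0 \<le> w j" "(\<Sum>j\<in>J. w j) = 1" "0 < c" "0 \<le> \<delta>"
    and V: "(\<Sum>\<sigma>\<in>I \<rightarrow>\<^sub>E J. ennreal (\<Prod>i\<in>I. w (\<sigma> i)) * V \<sigma>) \<le> ennreal (\<delta> * c)"
  shows "1 - \<delta> \<le> prod_avg I J w (\<lambda>\<sigma>. if V \<sigma> \<le> ennreal c then 1 else 0)"
proof -
  define bad :: "('a \<Rightarrow> 'b) \<Rightarrow> real" where "bad = (\<lambda>\<sigma>. if V \<sigma> \<le> ennreal c then 0 else 1)"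
  have wn: "0 \<le> (\<Prod>i\<in>I. w (\<sigma> i))" if "\<sigma> \<in> I \<rightarrow>\<^sub>E J" for \<sigma>
    using that assms(3) by (intro prod_nonneg) (auto simp: PiE_mem)
  have bn: "0 \<le> bad \<sigma>" for \<sigma> by (simp add: bad_def)
  have "ennreal (c * prod_avg I J w bad) = (\<Sum>\<sigma>\<in>I \<rightarrow>\<^sub>E J. ennreal (c * ((\<Prod>i\<in>I. w (\<sigma> i)) * bad \<sigma>)))"
    unfolding prod_avg_def sum_distrib_left using assms(5)
    by (intro sum_ennreal [symmetric] mult_nonneg_nonneg wn bn) auto
  also have "\<dots> \<le> (\<Sum>\<sigma>\<in>I \<rightarrow>\<^sub>E J. ennreal (\<Prod>i\<in>I. w (\<sigma> i)) * V \<sigma>)"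
  proof (rule sum_mono)
    fix \<sigma> assume \<sigma>: "\<sigma> \<in> I \<rightarrow>\<^sub>E J"
    have "ennreal (c * bad \<sigma>) \<le> V \<sigma>"
      by (cases "V \<sigma> \<le> ennreal c") (auto simp: bad_def)
    then have "ennreal (\<Prod>i\<in>I. w (\<sigma> i)) * ennreal (c * bad \<sigma>) \<le> ennreal (\<Prod>i\<in>I. w (\<sigma> i)) * V \<sigma>"
      by (intro mult_left_mono) auto
    moreover have "ennreal (\<Prod>i\<in>I. w (\<sigma> i)) * ennreal (c * bad \<sigma>)
        = ennreal (c * ((\<Prod>i\<in>I. w (\<sigma> i)) * bad \<sigma>))"
      using wn[OF \<sigma>] bn assms(5) by (simp add: ennreal_mult [symmetric] mult_ac)
    ultimately show "ennreal (c * ((\<Prod>i\<in>I. w (\<sigma> i)) * bad \<sigma>)) \<le> ennreal (\<Prod>i\<in>I. w (\<sigma> i)) * V \<sigma>"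
      by simp
  qed
  also note V
  finally have "prod_avg I J w bad \<le> \<delta>"
    using assms(5,6) by (simp add: ennreal_le_iff mult.commute[of \<delta>])
  moreover have "prod_avg I J w (\<lambda>\<sigma>. (if V \<sigma> \<le> ennreal c then 1 else 0) + bad \<sigma>) = 1"
    using prod_avg_const[OF assms(1,2,4), of 1] by (simp add: bad_def if_distrib cong: if_cong)
  ultimately show ?thesis by (simp add: prod_avg_add)
qed

text \<open>At a fixed point \<open>x\<close> the value \<open>f x / l1_norm N lam\<close> is the mean of
  \<open>sgn (lam j) * g j x\<close> when \<open>j\<close> has weight \<open>cmod (lam j) / l1_norm N lam\<close>, so the sampling error
  is, up to sign, a centred empirical mean of \<open>k\<close> independent copies.\<close>

lemma sample_error_moment_pointwise:
  assumes "0 < k" "0 < l1_norm N lam" "2 \<le> p" "f x = (\<Sum>j = 1..N. lam j * g j x)"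
  shows "prod_avg {1..k} {1..N} (\<lambda>j. cmod (lam j) / l1_norm N lam)
           (\<lambda>\<sigma>. cmod (sample_error N lam g f k \<sigma> x) powr p)
       \<le> (16 * p / real k) powr (p / 2)
           * (\<Sum>j = 1..N. cmod (lam j) / l1_norm N lam * cmod (g j x) powr p)"
proof -
  define L where "L = l1_norm N lam"
  define w where "w = (\<lambda>j. cmod (lam j) / L)"
  define a where "a = (\<lambda>j. sgn (lam j) * g j x)"
  have L: "0 < L" using assms by (simp add: L_def)
  have w0: "0 \<le> w j" for j using L by (simp add: w_def)
  have w1: "(\<Sum>j = 1..N. w j) = 1"
    using L by (simp add: w_def L_def l1_norm_def flip: sum_divide_distrib)
  have mean: "(\<Sum>j = 1..N. w j *\<^sub>R a j) = 1 / of_real L * f x"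
  proof -
    have "w j *\<^sub>R a j = 1 / of_real L * (lam j * g j x)" for j
      by (cases "lam j = 0") (simp_all add: w_def a_def sgn_div_norm scaleR_conv_of_real)
    then show ?thesis by (simp add: assms(4) sum_distrib_left)
  qed
  have err: "cmod (sample_error N lam g f k \<sigma> x) powr p
      = (1 / real k) powr p * cmod (\<Sum>i = 1..k. a (\<sigma> i) - (\<Sum>j = 1..N. w j *\<^sub>R a j)) powr p" for \<sigma>
  proof -
    have "sample_error N lam g f k \<sigma> x
        = - (1 / of_nat k * (\<Sum>i = 1..k. a (\<sigma> i) - (\<Sum>j = 1..N. w j *\<^sub>R a j)))"
      using assms(1) unfolding mean sample_error_def
      by (simp add: sum_subtractf a_def L_def field_simps)
    then have "cmod (sample_error N lam g f k \<sigma> x)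
        = 1 / real k * cmod (\<Sum>i = 1..k. a (\<sigma> i) - (\<Sum>j = 1..N. w j *\<^sub>R a j))"
      by (simp add: norm_mult norm_divide)
    then show ?thesis by (simp only: powr_mult)
  qed
  have "prod_avg {1..k} {1..N} w (\<lambda>\<sigma>. cmod (sample_error N lam g f k \<sigma> x) powr p)
      = (1 / real k) powr p *
        prod_avg {1..k} {1..N} w (\<lambda>\<sigma>. cmod (\<Sum>i = 1..k. a (\<sigma> i) - (\<Sum>j = 1..N. w j *\<^sub>R a j)) powr p)"
    unfolding err prod_avg_cmult ..
  also have "\<dots> \<le> (1 / real k) powr p *
      ((16 * p * real k) powr (p / 2) * (\<Sum>j = 1..N. w j * cmod (a j) powr p))"
    using centred_sum_moment[of "{1..k}" "{1..N}" w p a] w0 w1 assms(1,3)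
    by (intro mult_left_mono) auto
  also have "\<dots> = (16 * p / real k) powr (p / 2) * (\<Sum>j = 1..N. w j * cmod (a j) powr p)"
  proof -
    have "(1 / real k) powr p = (1 / real k) powr (p / 2) * (1 / real k) powr (p / 2)"
      using assms(1) by (simp flip: powr_add)
    moreover have "(1 / real k) powr (p / 2) * (1 / real k) powr (p / 2) * (16 * p * real k) powr (p / 2)
        = (16 * p / real k) powr (p / 2)"
      using assms(1) by (simp del: powr_divide flip: powr_mult)
    ultimately show ?thesis by (simp add: mult.assoc [symmetric])
  qed
  also have "\<dots> \<le> (16 * p / real k) powr (p / 2) * (\<Sum>j = 1..N. w j * cmod (g j x) powr p)"
  proof (intro mult_left_mono sum_mono w0 powr_mono2)
    show "cmod (a j) \<le> cmod (g j x)" for j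
      by (simp add: a_def norm_mult norm_sgn)
  qed (use assms(3) in auto)
  finally show ?thesis by (simp add: w_def L_def)
qed

lemma sample_error_measurable:
  assumes "\<And>j. j \<in> {1..N} \<Longrightarrow> g j \<in> borel_measurable M"
    and "\<And>x. x \<in> space M \<Longrightarrow> f x = (\<Sum>j = 1..N. lam j * g j x)" "\<sigma> \<in> tuples k N"
  shows "sample_error N lam g f k \<sigma> \<in> borel_measurable M"
proof -
  have [measurable]: "f \<in> borel_measurable M"
    using assms(1,2)
    by (subst measurable_cong[where g = "\<lambda>x. \<Sum>j = 1..N. lam j * g j x"])
       (auto intro!: borel_measurable_sum borel_measurable_times)
  have [measurable]: "g (\<sigma> i) \<in> borel_measurable M" if "i \<in> {1..k}" for i
    using that assms(3) by (intro assms(1)) (auto simp: tuples_def dest: PiE_mem)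
  have [measurable]: "(\<lambda>x. \<Sum>i = 1..k. sgn (lam (\<sigma> i)) * g (\<sigma> i) x) \<in> borel_measurable M"
    by (intro borel_measurable_sum borel_measurable_times) auto
  show ?thesis unfolding sample_error_def by measurable
qed

text \<open>Integrating the pointwise bound over \<open>M\<close>: because it is linear in the \<open>p\<close>-th powers of the
  \<open>g j\<close>, only their \<open>L\<^sup>p\<close> norms enter.\<close>

lemma sample_error_moment:
  assumes "0 < k" "0 < l1_norm N lam" "2 \<le> p"
    and g: "\<And>j. j \<in> {1..N} \<Longrightarrow> g j \<in> borel_measurable M"
           "\<And>j. j \<in> {1..N} \<Longrightarrow> Lp_norm M p (g j) \<le> 1"
    and f: "\<And>x. x \<in> space M \<Longrightarrow> f x = (\<Sum>j = 1..N. lam j * g j x)"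
  shows "(\<Sum>\<sigma>\<in>{1..k} \<rightarrow>\<^sub>E {1..N}. ennreal (\<Prod>i\<in>{1..k}. cmod (lam (\<sigma> i)) / l1_norm N lam)
            * (\<integral>\<^sup>+ x. ennreal (cmod (sample_error N lam g f k \<sigma> x) powr p) \<partial>M))
       \<le> ennreal ((16 * p / real k) powr (p / 2))"
proof -
  define w where "w = (\<lambda>j. cmod (lam j) / l1_norm N lam)"
  define K where "K = (16 * p / real k) powr (p / 2)"
  have w0: "0 \<le> w j" for j using assms(2) by (simp add: w_def)
  have w1: "(\<Sum>j = 1..N. w j) = 1"
    using assms(2) by (simp add: w_def l1_norm_def flip: sum_divide_distrib)
  have K0: "0 \<le> K" by (simp add: K_def)
  have m: "(\<lambda>x. ennreal (cmod (sample_error N lam g f k \<sigma> x) powr p)) \<in> borel_measurable M"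
    if "\<sigma> \<in> {1..k} \<rightarrow>\<^sub>E {1..N}" for \<sigma>
  proof -
    have [measurable]: "sample_error N lam g f k \<sigma> \<in> borel_measurable M"
      using that by (intro sample_error_measurable g(1) f) (auto simp: tuples_def)
    show ?thesis by measurable
  qed
  have "(\<Sum>\<sigma>\<in>{1..k} \<rightarrow>\<^sub>E {1..N}. ennreal (\<Prod>i\<in>{1..k}. w (\<sigma> i))
            * (\<integral>\<^sup>+ x. ennreal (cmod (sample_error N lam g f k \<sigma> x) powr p) \<partial>M))
      = (\<Sum>\<sigma>\<in>{1..k} \<rightarrow>\<^sub>E {1..N}. \<integral>\<^sup>+ x. ennreal (\<Prod>i\<in>{1..k}. w (\<sigma> i))
            * ennreal (cmod (sample_error N lam g f k \<sigma> x) powr p) \<partial>M)"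
    by (intro sum.cong refl nn_integral_cmult [symmetric] m)
  also have "\<dots> = (\<integral>\<^sup>+ x. (\<Sum>\<sigma>\<in>{1..k} \<rightarrow>\<^sub>E {1..N}. ennreal (\<Prod>i\<in>{1..k}. w (\<sigma> i))
            * ennreal (cmod (sample_error N lam g f k \<sigma> x) powr p)) \<partial>M)"
    by (intro nn_integral_sum [symmetric] borel_measurable_times_ennreal m) auto
  also have "\<dots> = (\<integral>\<^sup>+ x. ennreal (prod_avg {1..k} {1..N} w
            (\<lambda>\<sigma>. cmod (sample_error N lam g f k \<sigma> x) powr p)) \<partial>M)"
    unfolding prod_avg_def
    by (intro nn_integral_cong) (simp add: w0 prod_nonneg ennreal_mult [symmetric] sum_ennreal)
  also have "\<dots> \<le> (\<integral>\<^sup>+ x. ennreal (K * (\<Sum>j = 1..N. w j * cmod (g j x) powr p)) \<partial>M)"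
    unfolding w_def K_def
    by (intro nn_integral_mono ennreal_leI sample_error_moment_pointwise assms(1-3) f)
  also have "\<dots> = (\<integral>\<^sup>+ x. ennreal K * (\<Sum>j = 1..N. ennreal (w j) * ennreal (cmod (g j x) powr p)) \<partial>M)"
    by (intro nn_integral_cong)
       (simp add: K0 w0 ennreal_mult [symmetric] sum_ennreal sum_nonneg)
  also have "\<dots> = ennreal K * (\<Sum>j = 1..N. ennreal (w j) * (\<integral>\<^sup>+ x. ennreal (cmod (g j x) powr p) \<partial>M))"
  proof -
    have mg: "(\<lambda>x. ennreal (cmod (g j x) powr p)) \<in> borel_measurable M" if "j \<in> {1..N}" for j
      using g(1)[OF that] by measurable
    have "(\<integral>\<^sup>+ x. ennreal K * (\<Sum>j = 1..N. ennreal (w j) * ennreal (cmod (g j x) powr p)) \<partial>M)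
        = ennreal K * (\<integral>\<^sup>+ x. (\<Sum>j = 1..N. ennreal (w j) * ennreal (cmod (g j x) powr p)) \<partial>M)"
      by (intro nn_integral_cmult borel_measurable_sum borel_measurable_times_ennreal mg) auto
    also have "\<dots> = ennreal K * (\<Sum>j = 1..N. \<integral>\<^sup>+ x. ennreal (w j) * ennreal (cmod (g j x) powr p) \<partial>M)"
      by (subst nn_integral_sum) (auto intro!: borel_measurable_times_ennreal mg)
    also have "\<dots> = ennreal K * (\<Sum>j = 1..N. ennreal (w j) * (\<integral>\<^sup>+ x. ennreal (cmod (g j x) powr p) \<partial>M))"
      by (intro arg_cong2[where f = "(*)"] sum.cong refl nn_integral_cmult mg)
    finally show ?thesis .
  qed
  also have "\<dots> \<le> ennreal K * (\<Sum>j = 1..N. ennreal (w j) * 1)"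
    using g(2) Lp_norm_le_iff[of p 1 M] assms(3) by (intro mult_left_mono sum_mono) auto
  also have "\<dots> = ennreal K"
    using w1 by (simp add: w0 sum_ennreal)
  finally show ?thesis unfolding w_def K_def .
qed

lemma l1_norm_pos:
  assumes "j \<in> {1..N}" "lam j \<noteq> 0"
  shows "0 < l1_norm N lam"
  unfolding l1_norm_def using assms by (intro sum_pos2[of _ j]) auto

text \<open>With \<open>k\<close> about \<open>1600 * p / \<epsilon>\<^sup>2\<close> the \<open>p\<close>-th moment of the error is at most
  \<open>(\<epsilon>\<^sup>2 / 100) powr (p / 2)\<close>, and \<open>p / 2 \<ge> 1\<close> leaves the factor \<open>1 / 100\<close> that Markov's
  inequality needs. Rounding \<open>k\<close> up costs at most \<open>1 \<le> p / \<epsilon>\<^sup>2\<close>.\<close>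

lemma sampling_constant_1601: "sampling_constant 1601 M"
  unfolding sampling_constant_def
proof (intro allI impI, elim conjE)
  fix p \<epsilon> :: real and N :: nat and lam :: "nat \<Rightarrow> complex"
    and g :: "nat \<Rightarrow> 'a \<Rightarrow> complex" and f :: "'a \<Rightarrow> complex"
  assume p: "2 \<le> p" and e: "0 < \<epsilon>" "\<epsilon> < 1" and nz: "\<exists>j\<in>{1..N}. lam j \<noteq> 0"
    and g: "\<forall>j\<in>{1..N}. g j \<in> borel_measurable M \<and> Lp_norm M p (g j) \<le> 1"
    and f: "\<forall>x\<in>space M. f x = (\<Sum>j = 1..N. lam j * g j x)"
  define w where "w = (\<lambda>j. cmod (lam j) / l1_norm N lam)"
  define k where "k = nat \<lceil>1600 * p / \<epsilon>\<^sup>2\<rceil>"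
  define V where "V = (\<lambda>\<sigma>. \<integral>\<^sup>+ x. ennreal (cmod (sample_error N lam g f k \<sigma> x) powr p) \<partial>M)"
  have L: "0 < l1_norm N lam" using nz l1_norm_pos by blast
  have w1: "(\<Sum>j = 1..N. w j) = 1"
    using L by (simp add: w_def l1_norm_def flip: sum_divide_distrib)
  have pos: "0 < 1600 * p / \<epsilon>\<^sup>2" using p e by simp
  then have k0: "0 < k" by (simp add: k_def)
  have k_ge: "1600 * p / \<epsilon>\<^sup>2 \<le> real k" unfolding k_def by (rule real_nat_ceiling_ge)
  have "\<epsilon>\<^sup>2 \<le> 1" using e by (simp add: power_le_one)
  then have "1 \<le> p / \<epsilon>\<^sup>2" using p e by (simp add: field_simps)
  then have k_le: "real k \<le> 1601 * p / \<epsilon>\<^sup>2"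
    using of_nat_ceiling[of "1600 * p / \<epsilon>\<^sup>2"] pos unfolding k_def by linarith
  have small: "(16 * p / real k) powr (p / 2) \<le> 1 / 100 * \<epsilon> powr p"
  proof -
    have "16 * p / real k \<le> 1 / 100 * \<epsilon>\<^sup>2"
      using k_ge k0 e by (simp add: field_simps)
    then have "(16 * p / real k) powr (p / 2) \<le> (1 / 100 * \<epsilon>\<^sup>2) powr (p / 2)"
      using p by (intro powr_mono2) auto
    also have "\<dots> = (1 / 100) powr (p / 2) * \<epsilon> powr p"
      using e by (subst powr_mult) (simp_all add: powr_powr flip: powr_numeral)
    also have "\<dots> \<le> 1 / 100 * \<epsilon> powr p"
      using p powr_mono'[of 1 "p / 2" "1 / 100 :: real"] by (intro mult_right_mono) auto
    finally show ?thesis .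
  qed
  have "(\<Sum>\<sigma>\<in>{1..k} \<rightarrow>\<^sub>E {1..N}. ennreal (\<Prod>i\<in>{1..k}. w (\<sigma> i)) * V \<sigma>)
      \<le> ennreal ((16 * p / real k) powr (p / 2))"
    unfolding w_def V_def using g f by (intro sample_error_moment k0 L p) auto
  also have "\<dots> \<le> ennreal (1 / 100 * \<epsilon> powr p)"
    by (rule ennreal_leI[OF small])
  finally have "1 - 1 / 100 \<le> prod_avg {1..k} {1..N} w (\<lambda>\<sigma>. if V \<sigma> \<le> ennreal (\<epsilon> powr p) then 1 else 0)"
    using e L w1 by (intro prod_avg_markov) (auto simp: w_def)
  also have "\<dots> = measure (tuple_distr k N lam)
      {\<sigma> \<in> tuples k N. Lp_norm M p (sample_error N lam g f k \<sigma>) \<le> ennreal \<epsilon>}"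
    using p e by (subst measure_tuple_distr) (simp add: Lp_norm_le_iff w_def V_def)
  finally have prob: "99 / 100 \<le> measure (tuple_distr k N lam)
      {\<sigma> \<in> tuples k N. Lp_norm M p (sample_error N lam g f k \<sigma>) \<le> ennreal \<epsilon>}"
    by simp
  then have "{\<sigma> \<in> tuples k N. Lp_norm M p (sample_error N lam g f k \<sigma>) \<le> ennreal \<epsilon>} \<noteq> {}"
    by (auto simp del: Collect_empty_eq)
  then show "\<exists>k::nat. 0 < k \<and> real k \<le> 1601 * p / \<epsilon>\<^sup>2
          \<and> (\<exists>\<sigma>\<in>tuples k N. Lp_norm M p (sample_error N lam g f k \<sigma>) \<le> ennreal \<epsilon>)
          \<and> measure (tuple_distr k N lam)
               {\<sigma> \<in> tuples k N. Lp_norm M p (sample_error N lam g f k \<sigma>) \<le> ennreal \<epsilon>} \<ge> 99 / 100"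
    using k0 k_le prob by blast
qed

section \<open>Independence of the constant from the type of the space\<close>

text \<open>The assertion about \<open>g\<close> depends only on the joint distribution of the \<open>g j\<close>, a
  probability measure on the functions from indices to \<open>complex\<close>: pushing \<open>M\<close> forward along
  \<open>x \<mapsto> (g j x)\<^sub>j\<close> turns the \<open>g j\<close> into the coordinate functions and preserves
  every \<open>L\<^sup>p\<close> norm involved.\<close>

lemma universal_sampling_constant_imp:
  assumes "universal_sampling_constant C" "prob_space (M :: 'a measure)"
  shows "sampling_constant C M"
  unfolding sampling_constant_def
proof (intro allI impI, elim conjE)
  fix p \<epsilon> :: real and N :: nat and lam :: "nat \<Rightarrow> complex"
    and g :: "nat \<Rightarrow> 'a \<Rightarrow> complex" and f :: "'a \<Rightarrow> complex"
  assume p: "2 \<le> p" and e: "0 < \<epsilon>" "\<epsilon> < 1" and nz: "\<exists>j\<in>{1..N}. lam j \<noteq> 0"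
    and g: "\<forall>j\<in>{1..N}. g j \<in> borel_measurable M \<and> Lp_norm M p (g j) \<le> 1"
    and f: "\<forall>x\<in>space M. f x = (\<Sum>j = 1..N. lam j * g j x)"
  define P :: "(nat \<Rightarrow> complex) measure" where "P = PiM {1..N} (\<lambda>_. borel)"
  define T where "T = (\<lambda>x. \<lambda>j\<in>{1..N}. g j x)"
  define M' where "M' = distr M P T"
  define g' :: "nat \<Rightarrow> (nat \<Rightarrow> complex) \<Rightarrow> complex" where "g' = (\<lambda>j y. y j)"
  define f' where "f' = (\<lambda>y. \<Sum>j = 1..N. lam j * g' j y)"
  have T: "T \<in> measurable M P"
    unfolding T_def P_def using g by (intro measurable_restrict) auto
  have g'P: "g' j \<in> borel_measurable P" if "j \<in> {1..N}" for j
    using that unfolding g'_def P_def by (intro measurable_component_singleton)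
  have g'T: "g' j (T x) = g j x" if "j \<in> {1..N}" for j x
    using that by (simp add: g'_def T_def)
  have g': "g' j \<in> borel_measurable M' \<and> Lp_norm M' p (g' j) \<le> 1" if j: "j \<in> {1..N}" for j
    using g'P[OF j] g j unfolding M'_def
    by (simp add: Lp_norm_distr[OF T] g'T)
  have err: "Lp_norm M' p (sample_error N lam g' f' k \<sigma>) = Lp_norm M p (sample_error N lam g f k \<sigma>)"
    if \<sigma>: "\<sigma> \<in> tuples k N" for k \<sigma>
  proof -
    have "sample_error N lam g' f' k \<sigma> \<in> borel_measurable P"
      using g'P \<sigma> by (intro sample_error_measurable) (auto simp: f'_def)
    then have "Lp_norm M' p (sample_error N lam g' f' k \<sigma>)
        = Lp_norm M p (\<lambda>x. sample_error N lam g' f' k \<sigma> (T x))"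
      unfolding M'_def by (rule Lp_norm_distr[OF T])
    also have "\<dots> = Lp_norm M p (sample_error N lam g f k \<sigma>)"
    proof (rule Lp_norm_cong)
      fix x assume x: "x \<in> space M"
      have "g' (\<sigma> i) (T x) = g (\<sigma> i) x" if "i \<in> {1..k}" for i
        using that \<sigma> by (intro g'T) (auto simp: tuples_def PiE_mem)
      moreover have "f' (T x) = f x"
        using f x by (simp add: f'_def g'T)
      ultimately show "sample_error N lam g' f' k \<sigma> (T x) = sample_error N lam g f k \<sigma> x"
        by (simp add: sample_error_def)
    qed
    finally show ?thesis .
  qed
  have set_eq: "{\<sigma> \<in> tuples k N. Lp_norm M' p (sample_error N lam g' f' k \<sigma>) \<le> ennreal \<epsilon>}
      = {\<sigma> \<in> tuples k N. Lp_norm M p (sample_error N lam g f k \<sigma>) \<le> ennreal \<epsilon>}" for k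
    using err by auto
  have "sampling_constant C M'"
    using assms prob_space.prob_space_distr[OF assms(2) T]
    by (simp add: universal_sampling_constant_def M'_def)
  then have "\<exists>k::nat. 0 < k \<and> real k \<le> C * p / \<epsilon>\<^sup>2
          \<and> (\<exists>\<sigma>\<in>tuples k N. Lp_norm M' p (sample_error N lam g' f' k \<sigma>) \<le> ennreal \<epsilon>)
          \<and> measure (tuple_distr k N lam)
               {\<sigma> \<in> tuples k N. Lp_norm M' p (sample_error N lam g' f' k \<sigma>) \<le> ennreal \<epsilon>} \<ge> 99 / 100"
    unfolding sampling_constant_def using p e nz g' by (elim allE impE) (auto simp: f'_def)
  then show "\<exists>k::nat. 0 < k \<and> real k \<le> C * p / \<epsilon>\<^sup>2
          \<and> (\<exists>\<sigma>\<in>tuples k N. Lp_norm M p (sample_error N lam g f k \<sigma>) \<le> ennreal \<epsilon>)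
          \<and> measure (tuple_distr k N lam)
               {\<sigma> \<in> tuples k N. Lp_norm M p (sample_error N lam g f k \<sigma>) \<le> ennreal \<epsilon>} \<ge> 99 / 100"
    unfolding set_eq using err by auto
qed

theorem lemma3p2:
  shows "(\<exists>C. universal_sampling_constant C)
    \<and> (\<forall>C. universal_sampling_constant C \<longrightarrow>
          (\<forall>M :: 'a measure. prob_space M \<longrightarrow> sampling_constant C M))"
proof
  have "universal_sampling_constant 1601"
    by (simp add: universal_sampling_constant_def sampling_constant_1601)
  then show "\<exists>C. universal_sampling_constant C" ..
  show "\<forall>C. universal_sampling_constant C \<longrightarrow>
          (\<forall>M :: 'a measure. prob_space M \<longrightarrow> sampling_constant C M)"
    by (blast intro: universal_sampling_constant_imp)
qed

end
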